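(* Let $P$ and $Q$ be two equivalence relations on a set $U$ such that for every $x\in U$: if $|(P\cap Q)(x)|=1$, then $|P(x)|=1$ or $|Q(x)|=1$. Then $\mathit{RS}(P+Q)$ is a complete lattice such that for all $\mathcal{H}\subseteq\wp(U)$, $$\bigwedge_{X\in\mathcal{H}}(X_{P+Q},X^{P+Q})=\Big(\big(\bigcap_{X\in\mathcal{H}}X_{P+Q}\big)_{P+Q},\ \bigcap_{X\in\mathcal{H}}X^{P+Q}\Big)$$ and $$\bigvee_{X\in\mathcal{H}}(X_{P+Q},X^{P+Q})=\Big(\bigcup_{X\in\mathcal{H}}X_{P+Q},\ \big(\bigcup_{X\in\mathcal{H}}X^{P+Q}\big)^{P+Q}\Big).$$
   Context: For an equivalence relation $E$ on $U$ and $x\in U$, $E(x)=\{y\in U\mid (x,y)\in E\}$. $\wp(U)$ is the power set of $U$. For $X\subseteq U$, $X_{P+Q}=\{x\in U\mid P(x)\subseteq X \text{ or } Q(x)\subseteq X\}$ and $X^{P+Q}=\{x\in U\mid P(x)\cap X\neq\emptyset \text{ and } Q(x)\cap X\neq\emptyset\}$. The set $\mathit{RS}(P+Q)=\{(X_{P+Q},X^{P+Q})\mid X\subseteq U\}$ is ordered by $(A,B)\leq(C,D)$ iff $A\subseteq C$ and $B\subseteq D$; the meets and joins in the claim are taken in $\mathit{RS}(P+Q)$. An intersection over the empty family of subsets of $U$ is $U$. *)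

theory Defs
  imports "HOL-Algebra.Complete_Lattice"
begin

text \<open>The class \<open>E(x)\<close> of a relation \<open>E\<close> is the image \<open>E `` {x}\<close>.\<close>

definition lower_approx :: "'a set \<Rightarrow> 'a rel \<Rightarrow> 'a rel \<Rightarrow> 'a set \<Rightarrow> 'a set" where
  "lower_approx U P Q X = {x \<in> U. P `` {x} \<subseteq> X \<or> Q `` {x} \<subseteq> X}"

definition upper_approx :: "'a set \<Rightarrow> 'a rel \<Rightarrow> 'a rel \<Rightarrow> 'a set \<Rightarrow> 'a set" where
  "upper_approx U P Q X = {x \<in> U. P `` {x} \<inter> X \<noteq> {} \<and> Q `` {x} \<inter> X \<noteq> {}}"

definition rough_pair :: "'a set \<Rightarrow> 'a rel \<Rightarrow> 'a rel \<Rightarrow> 'a set \<Rightarrow> 'a set \<times> 'a set" where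
  "rough_pair U P Q X = (lower_approx U P Q X, upper_approx U P Q X)"

definition RS :: "'a set \<Rightarrow> 'a rel \<Rightarrow> 'a rel \<Rightarrow> ('a set \<times> 'a set) gorder" where
  "RS U P Q =
    \<lparr>carrier = {rough_pair U P Q X | X. X \<subseteq> U},
     eq = (=),
     le = (\<lambda>(A, B) (C, D). A \<subseteq> C \<and> B \<subseteq> D)\<rparr>"

text \<open>Intersection of a family of subsets of \<open>U\<close>; intersecting with \<open>U\<close> makes the
  intersection of the empty family \<open>U\<close> and changes no other intersection.\<close>

definition Inter_in :: "'a set \<Rightarrow> 'a set set \<Rightarrow> 'a set" where
  "Inter_in U F = U \<inter> \<Inter>F"

end

theory Submission
  imports Defs
begin

text \<open>
  Call a point \<open>x\<close> a singleton point if \<open>P(x) = {x}\<close> or \<open>Q(x) = {x}\<close>. A pair \<open>(A, B)\<close> is a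
  rough pair iff \<open>A \<subseteq> B\<close>, \<open>A\<close> is fixed by the lower and \<open>B\<close> by the upper approximation, and
  \<open>A\<close> and \<open>B\<close> contain the same singleton points: every other point has a
  nontrivial \<open>P \<inter> Q\<close>-class by hypothesis, so choosing one representative in each of these
  classes gives a set \<open>K\<close> that meets such a class without containing it, and \<open>A \<union> (B \<inter> K)\<close> has
  approximations \<open>A\<close> and \<open>B\<close>. The claimed meets and joins satisfy these conditions, and they
  are extremal because both approximations are monotone and idempotent.
\<close>

locale equiv_pair =
  fixes U :: "'a set" and P Q :: "'a rel"
  assumes equiv_P: "equiv U P" and equiv_Q: "equiv U Q"
begin

abbreviation low :: "'a set \<Rightarrow> 'a set" where "low \<equiv> lower_approx U P Q"
abbreviation upp :: "'a set \<Rightarrow> 'a set" where "upp \<equiv> upper_approx U P Q"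

definition singleton_points :: "'a set" where
  "singleton_points = {x \<in> U. P `` {x} = {x} \<or> Q `` {x} = {x}}"

section \<open>Order-theoretic interior and closure properties of the approximations\<close>

lemma class_self: "x \<in> U \<Longrightarrow> x \<in> P `` {x}" "x \<in> U \<Longrightarrow> x \<in> Q `` {x}"
  by (simp_all only: equiv_class_self[OF equiv_P] equiv_class_self[OF equiv_Q])

lemma class_subset: "P `` {x} \<subseteq> U" "Q `` {x} \<subseteq> U"
  using equiv_P equiv_Q by (auto simp: equiv_class_eq_iff)

lemma class_eq: "y \<in> P `` {x} \<Longrightarrow> P `` {y} = P `` {x}" "y \<in> Q `` {x} \<Longrightarrow> Q `` {y} = Q `` {x}"
  using equiv_class_eq[OF equiv_P, of x y] equiv_class_eq[OF equiv_Q, of x y] by auto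

lemma lower_mono: "X \<subseteq> Y \<Longrightarrow> low X \<subseteq> low Y"
  by (auto simp: lower_approx_def)

lemma upper_mono: "X \<subseteq> Y \<Longrightarrow> upp X \<subseteq> upp Y"
  by (fastforce simp: upper_approx_def)

lemma lower_subset: "low X \<subseteq> X"
  using class_self by (auto simp: lower_approx_def)

lemma upper_subset_U: "upp X \<subseteq> U"
  by (auto simp: upper_approx_def)

lemma subset_upper: "X \<subseteq> U \<Longrightarrow> X \<subseteq> upp X"
  using class_self by (fastforce simp: upper_approx_def)

text \<open>All points of a class share that class, so a class contained in \<open>X\<close>
  consists of points of \<open>low X\<close>.\<close>

lemma lower_idem: "low (low X) = low X"
proof
  show "low X \<subseteq> low (low X)"
  proof
    fix x assume x: "x \<in> low X"
    then consider "P `` {x} \<subseteq> X" | "Q `` {x} \<subseteq> X"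
      by (auto simp: lower_approx_def)
    then have "P `` {x} \<subseteq> low X \<or> Q `` {x} \<subseteq> low X"
    proof cases
      case 1
      have "y \<in> low X" if "y \<in> P `` {x}" for y
        using that class_eq(1)[OF that] class_subset(1)[of x] 1 by (auto simp: lower_approx_def)
      then show ?thesis by blast
    next
      case 2
      have "y \<in> low X" if "y \<in> Q `` {x}" for y
        using that class_eq(2)[OF that] class_subset(2)[of x] 2 by (auto simp: lower_approx_def)
      then show ?thesis by blast
    qed
    with x show "x \<in> low (low X)" by (simp add: lower_approx_def)
  qed
qed (rule lower_subset)

text \<open>Classes stay inside \<open>U\<close>, so a class meets \<open>X\<close> iff it is not
  contained in \<open>U - X\<close>; negation turns the "or" of \<open>low\<close> into the "and" of
  \<open>upp\<close>. Idempotence is transferred to \<open>upp\<close> along this duality.\<close>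

lemma upper_lower_dual: "X \<subseteq> U \<Longrightarrow> upp X = U - low (U - X)"
  using class_subset by (fastforce simp: lower_approx_def upper_approx_def)

lemma upper_idem:
  assumes "X \<subseteq> U" shows "upp (upp X) = upp X"
proof -
  have "upp (upp X) = U - low (U - upp X)"
    by (rule upper_lower_dual[OF upper_subset_U])
  also have "U - upp X = low (U - X)"
    using upper_lower_dual[OF assms] by (auto simp: lower_approx_def)
  finally show ?thesis
    by (simp add: lower_idem upper_lower_dual[OF assms])
qed

text \<open>Monotonicity keeps each fixed set \<open>low X\<close> inside \<open>low\<close> of the
  union. Hence the first component of a join is a plain union.\<close>

lemma lower_UN_lower: "low (\<Union>X\<in>H. low X) = (\<Union>X\<in>H. low X)"
proof
  show "(\<Union>X\<in>H. low X) \<subseteq> low (\<Union>X\<in>H. low X)"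
  proof (rule UN_least)
    fix X assume "X \<in> H"
    then have "low (low X) \<subseteq> low (\<Union>X\<in>H. low X)" by (intro lower_mono UN_upper)
    then show "low X \<subseteq> low (\<Union>X\<in>H. low X)" by (simp add: lower_idem)
  qed
qed (rule lower_subset)

lemma upper_Inter_upper:
  assumes "H \<subseteq> Pow U"
  shows "upp (Inter_in U (upp ` H)) = Inter_in U (upp ` H)"
proof
  show "upp (Inter_in U (upp ` H)) \<subseteq> Inter_in U (upp ` H)"
  proof
    fix x assume x: "x \<in> upp (Inter_in U (upp ` H))"
    have "x \<in> upp X" if "X \<in> H" for X
    proof -
      have "Inter_in U (upp ` H) \<subseteq> upp X" using that by (auto simp: Inter_in_def)
      then show ?thesis
        using x upper_mono upper_idem[of X] assms that by blast
    qed
    then show "x \<in> Inter_in U (upp ` H)"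
      using x upper_subset_U by (auto simp: Inter_in_def)
  qed
qed (rule subset_upper, simp add: Inter_in_def)

section \<open>Singleton points and the classes of \<open>P \<inter> Q\<close>\<close>

lemma singleton_lower: "x \<in> singleton_points \<Longrightarrow> x \<in> low X \<longleftrightarrow> x \<in> X"
proof
  show "x \<in> low X" if "x \<in> singleton_points" "x \<in> X"
    using that unfolding singleton_points_def lower_approx_def by (elim CollectE conjE disjE) simp_all
qed (use lower_subset in blast)

lemma singleton_upper: "x \<in> singleton_points \<Longrightarrow> x \<in> upp X \<longleftrightarrow> x \<in> X"
  using class_self by (fastforce simp: singleton_points_def upper_approx_def)

lemma class_inter_subset_fixed:
  assumes "low A = A" "x \<in> A" shows "(P \<inter> Q) `` {x} \<subseteq> A"
  using assms by (auto simp: lower_approx_def)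

text \<open>Points in one class of \<open>P \<inter> Q\<close> have the same \<open>P\<close>-class
  and the same \<open>Q\<close>-class, so \<open>upp\<close> cannot separate them.\<close>

lemma class_inter_subset_upper_fixed:
  assumes "upp B = B" "x \<in> B" shows "(P \<inter> Q) `` {x} \<subseteq> B"
proof
  fix y assume y: "y \<in> (P \<inter> Q) `` {x}"
  then have "P `` {y} = P `` {x}" "Q `` {y} = Q `` {x}" "y \<in> U"
    using class_eq[of y x] class_subset(1)[of x] by auto
  moreover have "x \<in> upp B" using assms by simp
  ultimately have "y \<in> upp B" by (simp add: upper_approx_def)
  with assms(1) show "y \<in> B" by simp
qed

lemma splitting_set_exists:
  obtains K where "\<And>x. x \<in> U \<Longrightarrow> (P \<inter> Q) `` {x} \<inter> K \<noteq> {}"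
    and "\<And>x. x \<in> U \<Longrightarrow> (P \<inter> Q) `` {x} \<noteq> {x} \<Longrightarrow> \<not> (P \<inter> Q) `` {x} \<subseteq> K"
proof
  let ?E = "\<lambda>x. (P \<inter> Q) `` {x}"
  \<comment> \<open>\<open>c x\<close> depends on \<open>x\<close> only through its class, so
    equivalent points get the same representative.\<close>
  define c where "c x = (SOME y. y \<in> ?E x)" for x
  have self: "x \<in> ?E x" if "x \<in> U" for x
    using class_self[OF that] by auto
  have c: "c x \<in> ?E x" if "x \<in> U" for x
    unfolding c_def using self[OF that] by (rule someI)
  have E_eq: "?E y = ?E x" if "y \<in> ?E x" for x y
    using class_eq[of y x] that by auto
  show "?E x \<inter> c ` U \<noteq> {}" if "x \<in> U" for x
    using c[OF that] that by blast
  show "\<not> ?E x \<subseteq> c ` U" if x: "x \<in> U" and ne: "?E x \<noteq> {x}" for x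
  proof
    assume sub: "?E x \<subseteq> c ` U"
    have "y = c x" if y: "y \<in> ?E x" for y
    proof -
      obtain z where z: "z \<in> U" "y = c z" using sub y by blast
      have "?E z = ?E x" using E_eq[OF y] E_eq[of y z] c[OF z(1)] z(2) by simp
      then show ?thesis using z(2) by (simp add: c_def)
    qed
    then have "?E x \<subseteq> {c x}" by blast
    then show False using self[OF x] ne by (metis singletonD subsetD subset_singletonD empty_iff)
  qed
qed

lemma carrier_RS: "carrier (RS U P Q) = rough_pair U P Q ` Pow U"
  by (auto simp: RS_def)

lemma le_RS: "le (RS U P Q) (A, B) (C, D) \<longleftrightarrow> A \<subseteq> C \<and> B \<subseteq> D"
  by (simp add: RS_def)

lemma partial_order_RS: "partial_order (RS U P Q)"
  by unfold_locales (auto simp: RS_def split: prod.splits)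

end

section \<open>Realising pairs of fixed sets as rough pairs\<close>

locale equiv_pair_singletons = equiv_pair +
  assumes card_class: "\<And>x. x \<in> U \<Longrightarrow> card ((P \<inter> Q) `` {x}) = 1 \<Longrightarrow>
           card (P `` {x}) = 1 \<or> card (Q `` {x}) = 1"
begin

lemma class_inter_nontrivial:
  assumes "x \<in> U" "x \<notin> singleton_points" shows "(P \<inter> Q) `` {x} \<noteq> {x}"
proof
  assume "(P \<inter> Q) `` {x} = {x}"
  then have "card (P `` {x}) = 1 \<or> card (Q `` {x}) = 1"
    using card_class[OF assms(1)] by simp
  \<comment> \<open>An infinite set has \<open>card\<close> 0, so \<open>card\<close> 1 really means
    a singleton, and its element is \<open>x\<close>.\<close>
  then have "P `` {x} = {x} \<or> Q `` {x} = {x}"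
    using class_self[OF assms(1)] by (metis card_1_singletonE singletonD)
  then show False
    using assms by (simp add: singleton_points_def)
qed

lemma rough_pairI:
  assumes "A \<subseteq> B" "B \<subseteq> U" and A: "low A = A" and B: "upp B = B"
    and S: "B \<inter> singleton_points \<subseteq> A"
  shows "(A, B) \<in> carrier (RS U P Q)"
proof -
  obtain K where K: "\<And>x. x \<in> U \<Longrightarrow> (P \<inter> Q) `` {x} \<inter> K \<noteq> {}"
    "\<And>x. x \<in> U \<Longrightarrow> (P \<inter> Q) `` {x} \<noteq> {x} \<Longrightarrow> \<not> (P \<inter> Q) `` {x} \<subseteq> K"
    using splitting_set_exists by blast
  define Z where "Z = A \<union> (B \<inter> K)"
  have ZB: "Z \<subseteq> B" using assms(1) by (auto simp: Z_def)
  have "low Z \<subseteq> A"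
  proof
    fix x assume x: "x \<in> low Z"
    then have xU: "x \<in> U" and xZ: "x \<in> Z" using lower_subset by (auto simp: lower_approx_def)
    show "x \<in> A"
    proof (cases "x \<in> singleton_points")
      case True
      then show ?thesis using xZ ZB S by blast
    next
      case False
      have "(P \<inter> Q) `` {x} \<subseteq> Z" using x by (auto simp: lower_approx_def)
      \<comment> \<open>The class of \<open>x\<close> lies in \<open>Z\<close> but not in
        \<open>K\<close>, so some \<open>y\<close> in it must come from \<open>A\<close>; being
        fixed by \<open>low\<close>, \<open>A\<close> then contains the whole class.\<close>
      moreover obtain y where y: "y \<in> (P \<inter> Q) `` {x}" "y \<notin> K"
        using K(2)[OF xU class_inter_nontrivial[OF xU False]] by blast
      ultimately have "y \<in> A" by (auto simp: Z_def)
      moreover have "x \<in> (P \<inter> Q) `` {y}"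
        using y(1) class_eq[of y x] class_self[OF xU] by auto
      ultimately show ?thesis using class_inter_subset_fixed[OF A] by blast
    qed
  qed
  moreover have "A \<subseteq> low Z"
    using lower_mono[of A Z] A by (simp add: Z_def)
  moreover have "upp Z \<subseteq> B"
    using upper_mono[OF ZB] B by simp
  moreover have "B \<subseteq> upp Z"
  proof
    fix x assume x: "x \<in> B"
    then have xU: "x \<in> U" using assms(2) by blast
    obtain y where "y \<in> (P \<inter> Q) `` {x}" "y \<in> K" using K(1)[OF xU] by blast
    \<comment> \<open>The class of \<open>x\<close> stays in \<open>B\<close>, so \<open>y\<close>
      lies in \<open>B \<inter> K\<close> and witnesses that both \<open>P(x)\<close> and
      \<open>Q(x)\<close> meet \<open>Z\<close>.\<close>
    then show "x \<in> upp Z"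
      using class_inter_subset_upper_fixed[OF B x] xU by (auto simp: Z_def upper_approx_def)
  qed
  ultimately have "(A, B) = rough_pair U P Q Z" by (simp add: rough_pair_def)
  moreover have "Z \<subseteq> U" using ZB assms(2) by blast
  ultimately show ?thesis by (auto simp: carrier_RS)
qed

section \<open>Meets and joins\<close>

lemma greatest_rough_pair:
  assumes H: "H \<subseteq> Pow U"
  shows "greatest (RS U P Q) (low (Inter_in U (low ` H)), Inter_in U (upp ` H))
           (Lower (RS U P Q) (rough_pair U P Q ` H))" (is "greatest _ (?A, ?B) _")
proof (rule greatest_LowerI)
  have low_upp: "low X \<subseteq> upp X" if "X \<in> H" for X
    using lower_subset[of X] subset_upper[of X] H that by blast
  have A: "?A \<subseteq> low X" if "X \<in> H" for X
    using lower_subset[of "Inter_in U (low ` H)"] that by (auto simp: Inter_in_def)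
  show "(?A, ?B) \<in> carrier (RS U P Q)"
  proof (rule rough_pairI)
    show "?A \<subseteq> ?B"
      using A low_upp lower_subset[of "Inter_in U (low ` H)"] by (fastforce simp: Inter_in_def)
    show "?B \<subseteq> U" by (simp add: Inter_in_def)
    \<comment> \<open>At a singleton point both components reduce to membership in every
      \<open>X\<close> of \<open>H\<close>.\<close>
    show "?B \<inter> singleton_points \<subseteq> ?A"
      by (auto simp: Inter_in_def singleton_lower singleton_upper)
  qed (simp_all add: lower_idem upper_Inter_upper[OF H])
  show "le (RS U P Q) (?A, ?B) x" if "x \<in> rough_pair U P Q ` H" for x
    using that A by (auto simp: rough_pair_def le_RS Inter_in_def)
  show "le (RS U P Q) y (?A, ?B)" if y: "y \<in> Lower (RS U P Q) (rough_pair U P Q ` H)" for y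
  proof -
    obtain Y where Y: "Y \<subseteq> U" "y = (low Y, upp Y)"
      using y by (auto simp: Lower_def carrier_RS rough_pair_def)
    have le: "low Y \<subseteq> low X" "upp Y \<subseteq> upp X" if "X \<in> H" for X
    proof -
      have "le (RS U P Q) (low Y, upp Y) (low X, upp X)"
        using y that H unfolding Y(2) Lower_def carrier_RS by (auto simp: rough_pair_def)
      then show "low Y \<subseteq> low X" "upp Y \<subseteq> upp X" by (simp_all add: le_RS)
    qed
    have "low Y \<subseteq> Inter_in U (low ` H)"
      using le(1) Y(1) lower_subset by (fastforce simp: Inter_in_def)
    \<comment> \<open>\<open>?A\<close> is the largest \<open>low\<close>-fixed set inside the
      intersection, and \<open>low Y\<close> is such a set.\<close>
    then have "low Y \<subseteq> ?A"
      using lower_mono lower_idem by metis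
    moreover have "upp Y \<subseteq> ?B"
      using le(2) upper_subset_U by (fastforce simp: Inter_in_def)
    ultimately show ?thesis by (simp add: Y(2) le_RS)
  qed
qed (use H in \<open>auto simp: carrier_RS\<close>)

lemma least_rough_pair:
  assumes H: "H \<subseteq> Pow U"
  shows "least (RS U P Q) (\<Union>X\<in>H. low X, upp (\<Union>X\<in>H. upp X))
           (Upper (RS U P Q) (rough_pair U P Q ` H))" (is "least _ (?A, ?B) _")
proof (rule least_UpperI)
  have low_upp: "low X \<subseteq> upp X" if "X \<in> H" for X
    using lower_subset[of X] subset_upper[of X] H that by blast
  have UN_U: "(\<Union>X\<in>H. upp X) \<subseteq> U" using upper_subset_U by blast
  have UN_B: "(\<Union>X\<in>H. upp X) \<subseteq> ?B" by (rule subset_upper[OF UN_U])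
  show "(?A, ?B) \<in> carrier (RS U P Q)"
  proof (rule rough_pairI)
    show "?A \<subseteq> ?B" using low_upp UN_B by blast
    show "?B \<inter> singleton_points \<subseteq> ?A"
      by (auto simp: singleton_lower singleton_upper)
  qed (simp_all add: lower_UN_lower upper_idem[OF UN_U] upper_subset_U)
  show "le (RS U P Q) x (?A, ?B)" if x: "x \<in> rough_pair U P Q ` H" for x
  proof -
    obtain X where "X \<in> H" "x = (low X, upp X)"
      using x by (auto simp: rough_pair_def)
    moreover from this have "low X \<subseteq> ?A" "upp X \<subseteq> ?B" using UN_B by blast+
    ultimately show ?thesis by (simp only: le_RS)
  qed
  show "le (RS U P Q) (?A, ?B) y" if y: "y \<in> Upper (RS U P Q) (rough_pair U P Q ` H)" for y
  proof -
    obtain Y where Y: "Y \<subseteq> U" "y = (low Y, upp Y)"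
      using y by (auto simp: Upper_def carrier_RS rough_pair_def)
    have le: "low X \<subseteq> low Y" "upp X \<subseteq> upp Y" if "X \<in> H" for X
    proof -
      have "le (RS U P Q) (low X, upp X) (low Y, upp Y)"
        using y that H unfolding Y(2) Upper_def carrier_RS by (auto simp: rough_pair_def)
      then show "low X \<subseteq> low Y" "upp X \<subseteq> upp Y" by (simp_all add: le_RS)
    qed
    have "(\<Union>X\<in>H. upp X) \<subseteq> upp Y" using le(2) by blast
    \<comment> \<open>Dually, \<open>?B\<close> is the smallest \<open>upp\<close>-fixed set
      containing the union.\<close>
    then have "?B \<subseteq> upp Y" using upper_mono upper_idem[OF Y(1)] by metis
    moreover have "?A \<subseteq> low Y" using le(1) by blast
    ultimately show ?thesis by (simp add: Y(2) le_RS)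
  qed
qed (use H in \<open>auto simp: carrier_RS\<close>)

section \<open>Completeness and the explicit formulas\<close>

lemma complete_lattice_RS: "complete_lattice (RS U P Q)"
proof -
  interpret partial_order "RS U P Q" by (rule partial_order_RS)
  show ?thesis
  proof
    fix C assume "C \<subseteq> carrier (RS U P Q)"
    \<comment> \<open>Every set of rough pairs is the image of a family of subsets of
      \<open>U\<close>, so the bounds found for such images suffice, the empty one included.\<close>
    then obtain H where H: "H \<subseteq> Pow U" "C = rough_pair U P Q ` H"
      unfolding carrier_RS by (rule subset_imageE)
    show "\<exists>s. least (RS U P Q) s (Upper (RS U P Q) C)"
      using least_rough_pair[OF H(1)] H(2) by blast
    show "\<exists>i. greatest (RS U P Q) i (Lower (RS U P Q) C)"
      using greatest_rough_pair[OF H(1)] H(2) by blast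
  qed
qed

text \<open>The meet is a \<open>SOME\<close>-choice of a greatest lower bound; antisymmetry makes
  that bound unique, hence equal to the pair found above.\<close>

lemma infi_rough_pair:
  assumes "H \<subseteq> Pow U"
  shows "(IINF\<^bsub>RS U P Q\<^esub> X:H. rough_pair U P Q X) =
    (low (Inter_in U (low ` H)), Inter_in U (upp ` H))"
  using partial_order.greatest_unique[OF partial_order_RS _ greatest_rough_pair[OF assms]]
    someI[where P = "\<lambda>i. greatest (RS U P Q) i (Lower (RS U P Q) (rough_pair U P Q ` H))",
      OF greatest_rough_pair[OF assms]]
  by (simp add: infi_def inf_def)

lemma supr_rough_pair:
  assumes "H \<subseteq> Pow U"
  shows "(SSUP\<^bsub>RS U P Q\<^esub> X:H. rough_pair U P Q X) =
    (\<Union>X\<in>H. low X, upp (\<Union>X\<in>H. upp X))"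
  using partial_order.least_unique[OF partial_order_RS _ least_rough_pair[OF assms]]
    someI[where P = "\<lambda>s. least (RS U P Q) s (Upper (RS U P Q) (rough_pair U P Q ` H))",
      OF least_rough_pair[OF assms]]
  by (simp add: supr_def sup_def)

end

theorem theorem3p6:
  fixes U :: "'a set" and P Q :: "'a rel"
  assumes "equiv U P" and "equiv U Q"
    and "\<And>x. x \<in> U \<Longrightarrow> card ((P \<inter> Q) `` {x}) = 1 \<Longrightarrow>
           card (P `` {x}) = 1 \<or> card (Q `` {x}) = 1"
  shows "complete_lattice (RS U P Q) \<and>
    (\<forall>H \<subseteq> Pow U.
      (IINF\<^bsub>RS U P Q\<^esub> X:H. rough_pair U P Q X) =
        (lower_approx U P Q (Inter_in U (lower_approx U P Q ` H)),
         Inter_in U (upper_approx U P Q ` H)) \<and>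
      (SSUP\<^bsub>RS U P Q\<^esub> X:H. rough_pair U P Q X) =
        (\<Union>X\<in>H. lower_approx U P Q X,
         upper_approx U P Q (\<Union>X\<in>H. upper_approx U P Q X)))"
proof -
  interpret equiv_pair_singletons U P Q
    using assms by unfold_locales
  show ?thesis
    using complete_lattice_RS infi_rough_pair supr_rough_pair by blast
qed

end
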